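(* Let $G$ be a connected graph with at least $2$ vertices. Then $\mu_{\rm t}(G)=0$ if and only if $\mathrm{bp}(G)=0$, i.e., if and only if every vertex of $G$ is the middle vertex of some convex $P_3$ in $G$.
   Context: All graphs are finite, simple and connected. For $X\subseteq V(G)$, two vertices $x,y$ are $X$-visible if there is a shortest $x,y$-path $P$ with $V(P)\cap X\subseteq\{x,y\}$; $X$ is a total mutual-visibility set if every pair of vertices of $G$ is $X$-visible. $\mu_{\rm t}(G)$ is the largest cardinality of a total mutual-visibility set of $G$. A subgraph $H$ of $G$ is convex if for all $x,y\in V(H)$ every shortest $x,y$-path of $G$ lies in $H$. A vertex is a bypass vertex if it is not the middle vertex of a convex $P_3$ in $G$; $\mathrm{bp}(G)$ is the number of bypass vertices. *)

theory Defs
  imports "Graph_Theory.Graph_Theory"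
begin

text \<open>
  A finite simple graph is an instance of the locale \<^locale>\<open>graph\<close>: a finite, loop-free, symmetric
  digraph without parallel arcs, each undirected edge \<open>uv\<close> being the pair of arcs \<open>(u,v)\<close>, \<open>(v,u)\<close>.
  Paths are given by their vertex lists (\<^const>\<open>vpath\<close>); the one-vertex list \<open>[x]\<close> is the
  path of length 0 from \<open>x\<close> to \<open>x\<close>.
\<close>

definition shortest_path :: "('a, 'b) pre_digraph \<Rightarrow> 'a \<Rightarrow> 'a vwalk \<Rightarrow> 'a \<Rightarrow> bool" where
  "shortest_path G x p y \<longleftrightarrow>
     vpath p G \<and> hd p = x \<and> last p = y \<and>
     (\<forall>q. vpath q G \<and> hd q = x \<and> last q = y \<longrightarrow> vwalk_length p \<le> vwalk_length q)"

definition visible :: "('a, 'b) pre_digraph \<Rightarrow> 'a set \<Rightarrow> 'a \<Rightarrow> 'a \<Rightarrow> bool" where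
  "visible G X x y \<longleftrightarrow> (\<exists>p. shortest_path G x p y \<and> set p \<inter> X \<subseteq> {x, y})"

definition total_mutual_visibility_set :: "('a, 'b) pre_digraph \<Rightarrow> 'a set \<Rightarrow> bool" where
  "total_mutual_visibility_set G X \<longleftrightarrow>
     X \<subseteq> verts G \<and> (\<forall>x\<in>verts G. \<forall>y\<in>verts G. visible G X x y)"

text \<open>
  For a finite connected graph the maximum ranges over a finite set that is nonempty, since the
  empty set is a total mutual-visibility set.
\<close>
definition mu_t :: "('a, 'b) pre_digraph \<Rightarrow> nat" where
  "mu_t G = Max (card ` {X. total_mutual_visibility_set G X})"

text \<open>
  \<^const>\<open>subgraph\<close> alone would admit subdigraphs containing only one of the two arcs of an edge,
  hence the requirement that \<open>H\<close> be a graph itself.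
\<close>
definition convex_subgraph :: "('a, 'b) pre_digraph \<Rightarrow> ('a, 'b) pre_digraph \<Rightarrow> bool" where
  "convex_subgraph H G \<longleftrightarrow>
     graph H \<and> subgraph H G \<and>
     (\<forall>x\<in>verts H. \<forall>y\<in>verts H. \<forall>p. shortest_path G x p y \<longrightarrow> vpath p H)"

definition P3_with_middle :: "('a, 'b) pre_digraph \<Rightarrow> 'a \<Rightarrow> bool" where
  "P3_with_middle H v \<longleftrightarrow>
     graph H \<and>
     (\<exists>u w. distinct [u, v, w] \<and> verts H = {u, v, w} \<and>
            arcs_ends H = {(u, v), (v, u), (v, w), (w, v)})"

definition middle_of_convex_P3 :: "('a, 'b) pre_digraph \<Rightarrow> 'a \<Rightarrow> bool" where
  "middle_of_convex_P3 G v \<longleftrightarrow> (\<exists>H. convex_subgraph H G \<and> P3_with_middle H v)"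

definition bypass_vertex :: "('a, 'b) pre_digraph \<Rightarrow> 'a \<Rightarrow> bool" where
  "bypass_vertex G v \<longleftrightarrow> v \<in> verts G \<and> \<not> middle_of_convex_P3 G v"

definition bp :: "('a, 'b) pre_digraph \<Rightarrow> nat" where
  "bp G = card {v. bypass_vertex G v}"

end

theory Submission
  imports Defs
begin

text \<open>
  If \<open>v\<close> is the middle of a convex \<open>P\<^sub>3\<close> with ends \<open>u\<close>, \<open>w\<close>, then every shortest \<open>u,w\<close>-path passes
  through \<open>v\<close>, so no total mutual-visibility set contains \<open>v\<close>. Conversely, if \<open>v\<close> is a bypass
  vertex, then \<open>{v}\<close> is a total mutual-visibility set: where a shortest path traverses \<open>a, v, b\<close>,
  the vertices \<open>a\<close>, \<open>b\<close> are distinct and nonadjacent, so they have a common neighbour \<open>c \<noteq> v\<close>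
  through which the path can be rerouted.
\<close>

lemma length_vwalk_to_vpath: "length (vwalk_to_vpath p) \<le> length p"
proof (induct p rule: vwalk_to_vpath_induct3)
  case (in_set x xs)
  have "length (dropWhile (\<lambda>y. y \<noteq> x) xs) \<le> length xs"
    by (rule length_dropWhile_le)
  with in_set show ?case by simp
qed simp_all

lemma shortest_pathD:
  assumes "shortest_path G x p y"
  shows "vpath p G" "hd p = x" "last p = y" "p \<noteq> []"
  using assms by (auto simp: shortest_path_def)

text \<open>Shortcutting a walk to a path never lengthens it, so minimality among paths extends to
  walks. Competitors of a shortest path then need not be shown to be distinct lists.\<close>

lemma shortest_path_length_le:
  assumes "shortest_path G x p y" "vwalk q G" "hd q = x" "last q = y"
  shows "length p \<le> length q"
proof -
  let ?q = "vwalk_to_vpath q"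
  have "vpath ?q G" "hd ?q = x" "last ?q = y"
    using assms by (simp_all add: vwalk_to_vpath_vpath vwalk_to_vpath_hd vwalk_to_vpath_last)
  then have "vwalk_length p \<le> vwalk_length ?q"
    using assms(1) unfolding shortest_path_def by blast
  \<comment> \<open>\<open>vwalk_length\<close> counts arcs and is one less than
    \<open>length\<close> only for nonempty lists.\<close>
  moreover have "?q \<noteq> []" "p \<noteq> []"
    using \<open>vpath ?q G\<close> shortest_pathD(1)[OF assms(1)] by auto
  ultimately have "length p \<le> length ?q"
    by (cases p; cases ?q) simp_all
  with length_vwalk_to_vpath[of q] show ?thesis by simp
qed

lemma ex_shortest_path_in_vwalk:
  assumes "shortest_path G x p y" "vwalk q G" "hd q = x" "last q = y" "length q = length p"
  obtains r where "shortest_path G x r y" "set r \<subseteq> set q"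
proof
  let ?r = "vwalk_to_vpath q"
  have "vpath ?r G" "hd ?r = x" "last ?r = y"
    using assms by (simp_all add: vwalk_to_vpath_vpath vwalk_to_vpath_hd vwalk_to_vpath_last)
  moreover have "vwalk_length ?r \<le> vwalk_length p"
    using length_vwalk_to_vpath[of q] assms(5) by simp
  ultimately show "shortest_path G x ?r y"
    using assms(1) unfolding shortest_path_def by (meson order_trans)
  show "set ?r \<subseteq> set q"
    by (auto intro: vwalk_to_vpath_subset)
qed

text \<open>Keeping \<open>a\<close> in both halves preserves every arc, so a segment between two
  vertices of a walk can be exchanged independently of the rest.\<close>

lemma (in wf_digraph) vwalk_append_Cons:
  "vwalk (xs @ a # ys) G \<longleftrightarrow> vwalk (xs @ [a]) G \<and> vwalk (a # ys) G"
proof (induct xs)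
  case Nil
  then show ?case by (cases ys) (auto intro: adj_in_verts)
next
  case (Cons x xs)
  then show ?case by (cases xs) auto
qed

lemma vpath_induce_subgraph_iff:
  "vpath p (G \<restriction> S) \<longleftrightarrow> vpath p G \<and> set p \<subseteq> S" if "S \<subseteq> verts G"
proof -
  have "arcs_ends (G \<restriction> S) = arcs_ends G \<inter> S \<times> S"
    by (auto simp: arcs_ends_def arc_to_ends_def)
  then show ?thesis
    using that by (auto simp: vpath_def vwalk_def dest: arcs_in_vwalk_arcs)
qed

text \<open>The subgraph induced on \<open>u\<close>, \<open>v\<close>, \<open>w\<close> is convex:
  its only nonadjacent pair is \<open>u\<close>, \<open>w\<close>, at distance 2 with sole common
  neighbour \<open>v\<close>. By contraposition, a bypass vertex between two distinct nonadjacent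
  neighbours can be replaced by another common neighbour.\<close>

lemma (in graph) middle_of_convex_P3I:
  assumes uv: "u \<rightarrow> v" and vw: "v \<rightarrow> w" and "u \<noteq> w" and "\<not> u \<rightarrow> w"
    and only: "\<And>c. u \<rightarrow> c \<Longrightarrow> c \<rightarrow> w \<Longrightarrow> c = v"
  shows "middle_of_convex_P3 G v"
proof -
  let ?S = "{u, v, w}"
  let ?H = "G \<restriction> ?S"
  have sym: "b \<rightarrow> a" if "a \<rightarrow> b" for a b
    using that sym_arcs by (rule arcs_ends_symmetric[rotated])
  have S: "?S \<subseteq> verts G"
    using uv vw by (auto intro: adj_in_verts)
  have neq: "u \<noteq> v" "v \<noteq> w"
    using uv vw adj_not_same by blast+
  have ind: "induced_subgraph ?H G"
    using S by (rule induced_induce)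
  have H: "graph ?H"
    using digraphI_induced[OF ind] induced_graph_imp_graph[OF ind]
    by (simp add: graph_def pseudo_graph_def digraph_def)
  have "set p \<subseteq> ?S" if xy: "x \<in> ?S" "y \<in> ?S" and p: "shortest_path G x p y" for x y p
  proof -
    note le = shortest_path_length_le[OF p]
    have path: "vwalk p G" "hd p = x" "last p = y" "p \<noteq> []"
      using shortest_pathD[OF p] by auto
    consider "x = y" | "x \<rightarrow> y" | "x = u" "y = w" | "x = w" "y = u"
      using xy uv vw sym by auto
    \<comment> \<open>\<open>length\<close> counts vertices, so 3 stands for distance 2. Each case
      compares \<open>p\<close> with an explicit walk inside \<open>?S\<close>.\<close>
    then have "length p \<le> 2 \<or> length p = 3 \<and> (x = u \<and> y = w \<or> x = w \<and> y = u)"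
    proof cases
      case 1
      then show ?thesis using le[of "[x]"] xy S by auto
    next
      case 2
      then show ?thesis using le[of "[x, y]"] xy S by auto
    next
      case 3
      then show ?thesis using le[of "[u, v, w]"] uv vw S by auto
    next
      case 4
      then show ?thesis using le[of "[w, v, u]"] uv vw sym S by auto
    qed
    then show ?thesis
    proof (elim disjE conjE)
      assume "length p \<le> 2"
      then have "set p \<subseteq> {x, y}"
        using path by (cases p; cases "tl p") auto
      with xy show ?thesis by auto
    next
      assume "length p = 3" and "x = u" "y = w"
      then obtain c where "p = [u, c, w]"
        using path by (auto simp: length_Suc_conv numeral_3_eq_3)
      with path(1) only show ?thesis by auto
    next
      assume "length p = 3" and "x = w" "y = u"
      then obtain c where "p = [w, c, u]"
        using path by (auto simp: length_Suc_conv numeral_3_eq_3)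
      with path(1) only sym show ?thesis by auto
    qed
  qed
  then have "convex_subgraph ?H G"
    unfolding convex_subgraph_def vpath_induce_subgraph_iff[OF S] induce_subgraph_verts
    by (intro conjI ballI allI impI H induced_imp_subgraph[OF ind]) (rule shortest_pathD(1))
  moreover have "arcs_ends ?H = arcs_ends G \<inter> ?S \<times> ?S"
    by (auto simp: arcs_ends_def arc_to_ends_def)
  then have "arcs_ends ?H = {(u, v), (v, u), (v, w), (w, v)}"
    using uv vw \<open>\<not> u \<rightarrow> w\<close> adj_not_same sym by auto
  then have "P3_with_middle ?H v"
    using H neq \<open>u \<noteq> w\<close> unfolding P3_with_middle_def
    by (intro conjI exI[of _ u] exI[of _ w]) simp_all
  ultimately show ?thesis
    unfolding middle_of_convex_P3_def by blast
qed

lemma middle_of_convex_P3_notin_total_mutual_visibility_set: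
  assumes "middle_of_convex_P3 G v" and "total_mutual_visibility_set G X"
  shows "v \<notin> X"
proof
  assume "v \<in> X"
  obtain H u w where H: "convex_subgraph H G" and dist: "distinct [u, v, w]"
    and verts: "verts H = {u, v, w}"
    and arcs: "arcs_ends H = {(u, v), (v, u), (v, w), (w, v)}"
    using assms(1) unfolding middle_of_convex_P3_def P3_with_middle_def by blast
  have "u \<in> verts G" "w \<in> verts G"
    using H verts by (auto simp: convex_subgraph_def subgraph_def)
  then obtain p where p: "shortest_path G u p w" "set p \<inter> X \<subseteq> {u, w}"
    using assms(2) unfolding total_mutual_visibility_set_def visible_def by blast
  have "vpath p H"
    using H verts p(1) by (auto simp: convex_subgraph_def)
  \<comment> \<open>Since \<open>u\<close> and \<open>w\<close> differ, \<open>p\<close> has a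
    second vertex, and the only arc of \<open>H\<close> leaving \<open>u\<close> ends in
    \<open>v\<close>.\<close>
  moreover obtain c q where "p = u # c # q"
    using shortest_pathD[OF p(1)] dist
    by (cases p; cases "tl p") auto
  ultimately have "(u, c) \<in> arcs_ends H"
    by (auto simp: vpath_def vwalk_def)
  then have "v \<in> set p"
    using arcs dist \<open>p = u # c # q\<close> by auto
  with p(2) \<open>v \<in> X\<close> dist show False by auto
qed

lemma (in graph) ex_shortest_path:
  assumes "connected G" "x \<in> verts G" "y \<in> verts G"
  obtains p where "shortest_path G x p y"
proof -
  let ?P = "\<lambda>p. vpath p G \<and> hd p = x \<and> last p = y"
  \<comment> \<open>\<open>connected\<close> concerns the symmetric closure; as the arcs are already
    symmetric, it yields directed reachability.\<close>
  have "x \<rightarrow>\<^sup>* y"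
    using symmetric_connected_imp_strongly_connected[OF sym_arcs assms(1)] assms(2,3)
    by (auto simp: strongly_connected_def)
  then obtain q where "?P q"
    by (auto simp: reachable_vpath_conv)
  from ex_has_least_nat[of ?P, OF this, of vwalk_length] show thesis
    using that unfolding shortest_path_def by blast
qed

lemma (in graph) total_mutual_visibility_set_empty:
  "connected G \<Longrightarrow> total_mutual_visibility_set G {}"
  unfolding total_mutual_visibility_set_def visible_def
  by (auto elim: ex_shortest_path)

lemma (in graph) total_mutual_visibility_set_bypass_vertex:
  assumes "connected G" "bypass_vertex G v"
  shows "total_mutual_visibility_set G {v}"
proof -
  have "visible G {v} x y" if xy: "x \<in> verts G" "y \<in> verts G" for x y
  proof -
    obtain p where p: "shortest_path G x p y"
      using assms(1) xy by (rule ex_shortest_path)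
    show ?thesis
    proof (cases "v \<in> set p \<and> v \<noteq> x \<and> v \<noteq> y")
      case False
      with p show ?thesis unfolding visible_def by (intro exI[of _ p]) auto
    next
      case True
      then obtain ps qs where "p = ps @ v # qs"
        by (meson split_list)
      moreover from this have "ps \<noteq> []" "qs \<noteq> []"
        using True shortest_pathD(2,3)[OF p] by auto
      ultimately obtain xs a b ys where p_eq: "p = xs @ a # v # b # ys"
        by (cases ps rule: rev_cases; cases qs) auto
      \<comment> \<open>The segment \<open>m\<close> replaces \<open>[v]\<close>:
        \<open>m = []\<close> shows that \<open>a\<close> and \<open>b\<close> are nonadjacent, as
        \<open>p\<close> would otherwise be shortened, and \<open>m = [c]\<close> gives the
        detour.\<close>
      have splice: "vwalk (xs @ a # m @ b # ys) G \<and> hd (xs @ a # m @ b # ys) = x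
          \<and> last (xs @ a # m @ b # ys) = y" if "vwalk (a # m @ [b]) G" for m
        using that shortest_pathD(1-3)[OF p] vwalk_append_Cons[of xs a "v # b # ys"]
          vwalk_append_Cons[of xs a "m @ b # ys"] vwalk_append_Cons[of "a # m" b ys]
        by (auto simp: p_eq vpath_def hd_append)
      note le = shortest_path_length_le[OF p]
      have walk: "a \<rightarrow> v" "v \<rightarrow> b"
        using shortest_pathD(1)[OF p] vwalk_append_Cons[of xs a "v # b # ys"]
        by (auto simp: p_eq vpath_def)
      have "a \<noteq> b"
        using shortest_pathD(1)[OF p] by (auto simp: p_eq vpath_def)
      moreover have "\<not> a \<rightarrow> b"
      proof
        assume "a \<rightarrow> b"
        then have "vwalk (a # [] @ [b]) G" by (auto intro: adj_in_verts)
        from splice[OF this] le[of "xs @ a # [] @ b # ys"] show False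
          by (simp add: p_eq)
      qed
      ultimately obtain c where c: "a \<rightarrow> c" "c \<rightarrow> b" "c \<noteq> v"
        using middle_of_convex_P3I[OF walk] assms(2) by (auto simp: bypass_vertex_def)
      then have "vwalk (a # [c] @ [b]) G" by (auto intro: adj_in_verts)
      \<comment> \<open>The detour is only known to be a walk. It has as many vertices as
        \<open>p\<close>, so shortcutting it gives a shortest path on a subset of its
        vertices.\<close>
      from splice[OF this] obtain r where "shortest_path G x r y"
          "set r \<subseteq> set (xs @ a # [c] @ b # ys)"
        using ex_shortest_path_in_vwalk[OF p, of "xs @ a # [c] @ b # ys"] by (auto simp: p_eq)
      moreover have "v \<notin> set (xs @ a # [c] @ b # ys)"
        using shortest_pathD(1)[OF p] c(3) by (auto simp: p_eq vpath_def)
      ultimately show ?thesis unfolding visible_def by blast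
    qed
  qed
  with assms(2) show ?thesis
    by (auto simp: total_mutual_visibility_set_def bypass_vertex_def)
qed

lemma (in graph) mu_t_eq_0_iff:
  assumes "connected G"
  shows "mu_t G = 0 \<longleftrightarrow> (\<forall>v\<in>verts G. middle_of_convex_P3 G v)"
proof -
  let ?T = "{X. total_mutual_visibility_set G X}"
  have T: "?T \<subseteq> Pow (verts G)"
    by (auto simp: total_mutual_visibility_set_def)
  then have fin: "finite ?T" "\<And>X. X \<in> ?T \<Longrightarrow> finite X"
    using finite_verts by (blast intro: finite_subset finite_Pow_iff[THEN iffD2])+
  \<comment> \<open>The empty set makes the range of \<open>Max\<close> nonempty and attains 0, so
    the maximum is 0 exactly when every member of \<open>?T\<close> is empty.\<close>
  have "0 \<in> card ` ?T"
    using total_mutual_visibility_set_empty[OF assms] by (auto intro: rev_image_eqI)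
  then have "mu_t G = 0 \<longleftrightarrow> (\<forall>X\<in>?T. X = {})"
    using fin unfolding mu_t_def by (subst Max_eq_iff) auto
  \<comment> \<open>A bypass vertex \<open>v\<close> contributes the nonempty member
    \<open>{v}\<close>; if there is none, no vertex can belong to a member of
    \<open>?T\<close>.\<close>
  also have "\<dots> \<longleftrightarrow> (\<forall>v\<in>verts G. middle_of_convex_P3 G v)"
    using total_mutual_visibility_set_bypass_vertex[OF assms] T
      middle_of_convex_P3_notin_total_mutual_visibility_set[of G]
    by (fastforce simp: bypass_vertex_def)
  finally show ?thesis .
qed

lemma (in fin_digraph) bp_eq_0_iff:
  "bp G = 0 \<longleftrightarrow> (\<forall>v\<in>verts G. middle_of_convex_P3 G v)"
proof -
  \<comment> \<open>An infinite set would have \<open>card\<close> 0 as well, so emptiness follows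
    only with finiteness.\<close>
  have "finite {v. bypass_vertex G v}"
    by (rule finite_subset[OF _ finite_verts]) (auto simp: bypass_vertex_def)
  then show ?thesis
    by (auto simp: bp_def bypass_vertex_def)
qed

theorem theorem3p3:
  fixes G :: "('a, 'b) pre_digraph"
  assumes "graph G"
    and "connected G"
    and "card (verts G) \<ge> 2"
  shows "(mu_t G = 0 \<longleftrightarrow> bp G = 0) \<and>
         (mu_t G = 0 \<longleftrightarrow> (\<forall>v\<in>verts G. middle_of_convex_P3 G v))"
proof -
  interpret graph G by fact
  show ?thesis
    using mu_t_eq_0_iff[OF assms(2)] bp_eq_0_iff by simp
qed

end
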